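(* Let $\gamma_1(t)$ and $\gamma_2(t)$ be two regular $C^\infty$ curves in the affine plane $\mathbb{R}^2$, each having a positive generic inflection point at $t=0$. Then $\gamma_1$ and $\gamma_2$ have the same affine inflectional curvature $\mu_I$ at $t=0$ if and only if there exist an orientation preserving equi-affine transformation $T$ of $\mathbb{R}^2$ and a parametrization $u=u(t)$ near $t=0$ (with $u(0)=0$) such that $du/dt>0$ and $|T\circ\gamma_2\circ u(t)-\gamma_1(t)|$ has order higher than $t^4$ (i.e. is $o(t^4)$ as $t\to0$).
   Context: For $\mathbf a,\mathbf b\in\mathbb{R}^2$, $[\mathbf a,\mathbf b]=a_1b_2-a_2b_1$. A point $t=0$ of a regular curve $\gamma$ is an inflection point if $[\dot\gamma(0),\ddot\gamma(0)]=0$; it is generic if moreover $[\dot\gamma(0),\gamma^{(3)}(0)]\ne0$. A generic inflection point is positive (resp. negative) if $[\dot\gamma(0),\gamma^{(3)}(0)]>0$ (resp. $<0$). An equi-affine transformation is an affine transformation of $\mathbb{R}^2$ with Jacobian $\pm1$; it is orientation preserving if the Jacobian is $1$. The affine inflectional curvature at a generic inflection point $t=0$ is $$\mu_I=\epsilon_I\,\frac{[\dot\gamma(0),\gamma^{(4)}(0)]-6[\ddot\gamma(0),\gamma^{(3)}(0)]}{\bigl|[\dot\gamma(0),\gamma^{(3)}(0)]\bigr|^{5/4}},\qquad \epsilon_I=\operatorname{sgn}[\dot\gamma(0),\gamma^{(3)}(0)].$$ *)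

theory Defs
  imports "HOL-Analysis.Analysis" "HOL-Library.Landau_Symbols"
begin

definition bracket :: "real^2 \<Rightarrow> real^2 \<Rightarrow> real" where
  "bracket a b = a $ 1 * b $ 2 - a $ 2 * b $ 1"

definition nth_derivative :: "nat \<Rightarrow> (real \<Rightarrow> 'a::real_normed_vector) \<Rightarrow> real \<Rightarrow> 'a" where
  "nth_derivative n f = ((\<lambda>g t. vector_derivative g (at t)) ^^ n) f"

text \<open>\<^term>\<open>smooth_on_open I f\<close> is meant for open \<^term>\<open>I\<close>. Since \<^const>\<open>vector_derivative\<close>
  is total, the existence of every derivative is stated by differentiability.\<close>

definition smooth_on_open :: "real set \<Rightarrow> (real \<Rightarrow> 'a::real_normed_vector) \<Rightarrow> bool" where
  "smooth_on_open I f \<longleftrightarrow> (\<forall>n. \<forall>t\<in>I. nth_derivative n f differentiable (at t))"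

definition open_interval_around_0 :: "real set \<Rightarrow> bool" where
  "open_interval_around_0 I \<longleftrightarrow> open I \<and> is_interval I \<and> 0 \<in> I"

definition regular_smooth_curve :: "real set \<Rightarrow> (real \<Rightarrow> real^2) \<Rightarrow> bool" where
  "regular_smooth_curve I \<gamma> \<longleftrightarrow> smooth_on_open I \<gamma> \<and> (\<forall>t\<in>I. nth_derivative 1 \<gamma> t \<noteq> 0)"

definition inflection_at_0 :: "(real \<Rightarrow> real^2) \<Rightarrow> bool" where
  "inflection_at_0 \<gamma> \<longleftrightarrow> bracket (nth_derivative 1 \<gamma> 0) (nth_derivative 2 \<gamma> 0) = 0"

definition generic_inflection_at_0 :: "(real \<Rightarrow> real^2) \<Rightarrow> bool" where
  "generic_inflection_at_0 \<gamma> \<longleftrightarrow> inflection_at_0 \<gamma> \<and>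
     bracket (nth_derivative 1 \<gamma> 0) (nth_derivative 3 \<gamma> 0) \<noteq> 0"

definition positive_generic_inflection_at_0 :: "(real \<Rightarrow> real^2) \<Rightarrow> bool" where
  "positive_generic_inflection_at_0 \<gamma> \<longleftrightarrow> generic_inflection_at_0 \<gamma> \<and>
     bracket (nth_derivative 1 \<gamma> 0) (nth_derivative 3 \<gamma> 0) > 0"

definition affine_inflectional_curvature :: "(real \<Rightarrow> real^2) \<Rightarrow> real" where
  "affine_inflectional_curvature \<gamma> =
     sgn (bracket (nth_derivative 1 \<gamma> 0) (nth_derivative 3 \<gamma> 0)) *
     ((bracket (nth_derivative 1 \<gamma> 0) (nth_derivative 4 \<gamma> 0)
        - 6 * bracket (nth_derivative 2 \<gamma> 0) (nth_derivative 3 \<gamma> 0)) /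
      \<bar>bracket (nth_derivative 1 \<gamma> 0) (nth_derivative 3 \<gamma> 0)\<bar> powr (5/4))"

definition orientation_preserving_equi_affine :: "(real^2 \<Rightarrow> real^2) \<Rightarrow> bool" where
  "orientation_preserving_equi_affine T \<longleftrightarrow>
     (\<exists>(A :: real^2^2) b. det A = 1 \<and> T = (\<lambda>x. A *v x + b))"

end

theory Submission
  imports Defs
begin

text \<open>
  Two smooth curves agree up to \<open>o(t\<^sup>4)\<close> exactly when their derivatives of order \<open>0, \<dots>, 4\<close>
  at \<open>0\<close> coincide (\<open>smallo_power_iff_derivatives_vanish\<close>). So the geometric condition is a
  condition on finitely many vectors: writing \<open>a\<^sub>k\<close> and \<open>b\<^sub>k\<close> for the derivatives of \<open>\<gamma>2\<close> and
  \<open>\<gamma>1\<close> at \<open>0\<close>, and \<open>c\<^sub>k\<close> for those of \<open>\<gamma>2 \<circ> u\<close>, it asks for a matrix \<open>A\<close> of determinant \<open>1\<close>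
  with \<open>A c\<^sub>k = b\<^sub>k\<close> for \<open>1 \<le> k \<le> 4\<close>; the translation part takes care of \<open>k = 0\<close>
  (\<open>contact_order_4_iff\<close>).

  At an inflection point the numbers \<open>L = [a\<^sub>1, a\<^sub>3]\<close> and \<open>N = [a\<^sub>1, a\<^sub>4] - 6 [a\<^sub>2, a\<^sub>3]\<close> are
  invariant under unimodular \<open>A\<close>, and a reparametrization with \<open>u'(0) = r\<close> multiplies them by
  \<open>r\<^sup>4\<close> and \<open>r\<^sup>5\<close>: the factor \<open>6\<close> is what makes the contributions of the higher derivatives of
  \<open>u\<close> cancel (\<open>comp_deriv_brackets\<close>). Hence equivalent curves have \<open>(L', N') = (r\<^sup>4 L, r\<^sup>5 N)\<close>
  for some \<open>r > 0\<close>, which for positive \<open>L\<close>, \<open>L'\<close> says exactly that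
  \<open>N / L\<^bsup>5/4\<^esup> = N' / L'\<^bsup>5/4\<^esup>\<close> (\<open>weighted_ratio_eq_iff_scaling\<close>).

  Conversely, suppose that the pairs are related by such an \<open>r\<close>. The frames \<open>(c\<^sub>1, c\<^sub>3)\<close> and
  \<open>(b\<^sub>1, b\<^sub>3)\<close> then span the same area, so exactly one \<open>A\<close> of determinant \<open>1\<close> carries one to
  the other. The vectors \<open>c\<^sub>2\<close>, \<open>b\<^sub>2\<close> are multiples of \<open>c\<^sub>1\<close>, \<open>b\<^sub>1\<close>, and \<open>u''(0)\<close> can be chosen to
  match the multiples. Of the two coordinates of \<open>c\<^sub>4\<close>, one is matched by the choice of the fourth
  derivative of \<open>u\<close>, while the other is correct because of the relation between \<open>N\<close> and \<open>N'\<close>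
  (\<open>jets_equivalent_if_scaling\<close>). A polynomial \<open>u\<close> realises the chosen derivatives.
\<close>

section \<open>Iterated derivatives\<close>

lemma nth_derivative_0 [simp]: "nth_derivative 0 f = f"
  by (simp add: nth_derivative_def)

lemma nth_derivative_Suc:
  "nth_derivative (Suc n) f = (\<lambda>t. vector_derivative (nth_derivative n f) (at t))"
  by (simp add: nth_derivative_def)

lemma smooth_on_open_has_vector_derivative:
  assumes "smooth_on_open I f" "t \<in> I"
  shows "(nth_derivative n f has_vector_derivative nth_derivative (Suc n) f t) (at t)"
  using assms unfolding smooth_on_open_def nth_derivative_Suc
  by (simp add: vector_derivative_works)

section \<open>Order of vanishing and derivatives\<close>

text \<open>The intermediate point is strictly between \<open>0\<close> and \<open>t\<close>. That it differs from \<open>0\<close>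
  matters below, where \<^term>\<open>f'\<close> is controlled only on a punctured neighbourhood.\<close>

lemma mvt_norm_between:
  fixes f :: "real \<Rightarrow> 'a::real_inner"
  assumes "t \<noteq> 0"
    and der: "\<And>x. \<bar>x\<bar> \<le> \<bar>t\<bar> \<Longrightarrow> (f has_vector_derivative f' x) (at x)"
  obtains x where "x \<noteq> 0" "\<bar>x\<bar> < \<bar>t\<bar>" "norm (f t - f 0) \<le> \<bar>t\<bar> * norm (f' x)"
proof -
  define a b where "a = min 0 t" and "b = max 0 t"
  have ab: "a < b" "b - a = \<bar>t\<bar>" using assms(1) by (auto simp: a_def b_def)
  have mem: "\<bar>x\<bar> \<le> \<bar>t\<bar>" if "x \<in> {a..b}" for x
    using that by (auto simp: a_def b_def min_def max_def split: if_splits)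
  have "continuous_on {a..b} f"
    using der mem by (meson continuous_at_imp_continuous_on has_vector_derivative_continuous)
  moreover have "(f has_derivative (\<lambda>h. h *\<^sub>R f' x)) (at x)" if "a < x" "x < b" for x
    using der[OF mem, of x] that by (simp add: has_vector_derivative_def)
  ultimately obtain x where x: "x \<in> {a<..<b}" "norm (f b - f a) \<le> norm ((b - a) *\<^sub>R f' x)"
    using mvt_general[OF ab(1), of f "\<lambda>x h. h *\<^sub>R f' x"] by blast
  show ?thesis
  proof
    show "x \<noteq> 0" "\<bar>x\<bar> < \<bar>t\<bar>"
      using x(1) by (auto simp: a_def b_def min_def max_def split: if_splits)
    show "norm (f t - f 0) \<le> \<bar>t\<bar> * norm (f' x)"
      using x(2) ab(2) by (auto simp: a_def b_def min_def max_def norm_minus_commute split: if_splits)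
  qed
qed

lemma smallo_power_Suc_if_derivative_smallo:
  fixes f :: "real \<Rightarrow> 'a::real_inner"
  assumes "open S" "0 \<in> S" "f 0 = 0"
    and der: "\<And>t. t \<in> S \<Longrightarrow> (f has_vector_derivative f' t) (at t)"
    and small: "(\<lambda>t. norm (f' t)) \<in> o[at 0](\<lambda>t. t ^ n)"
  shows "(\<lambda>t. norm (f t)) \<in> o[at 0](\<lambda>t. t ^ Suc n)"
proof (rule landau_o.smallI)
  fix c :: real assume "c > 0"
  with small have "eventually (\<lambda>t. norm (f' t) \<le> c * \<bar>t\<bar> ^ n) (at 0)"
    by (auto dest!: landau_o.smallD[of _ _ _ c] simp: power_abs)
  moreover have "eventually (\<lambda>t. t \<in> S) (at 0)"
    using assms(1,2) by (simp add: eventually_at_in_open')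
  ultimately have "eventually (\<lambda>t. norm (f' t) \<le> c * \<bar>t\<bar> ^ n \<and> t \<in> S) (at 0)"
    by eventually_elim auto
  then obtain d where "d > 0"
    and d: "\<And>t. t \<noteq> 0 \<Longrightarrow> \<bar>t\<bar> < d \<Longrightarrow> norm (f' t) \<le> c * \<bar>t\<bar> ^ n \<and> t \<in> S"
    unfolding eventually_at by (auto simp: dist_real_def)
  show "eventually (\<lambda>t. norm (norm (f t)) \<le> c * norm (t ^ Suc n)) (at 0)"
    unfolding eventually_at
  proof (intro exI[of _ d] conjI ballI impI \<open>d > 0\<close>)
    fix t :: real assume t: "t \<noteq> 0 \<and> dist t 0 < d"
    have "(f has_vector_derivative f' x) (at x)" if "\<bar>x\<bar> \<le> \<bar>t\<bar>" for x
      using der d[of x] assms(2) t that by (cases "x = 0") (auto simp: dist_real_def)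
    then obtain x where x: "x \<noteq> 0" "\<bar>x\<bar> < \<bar>t\<bar>" "norm (f t - f 0) \<le> \<bar>t\<bar> * norm (f' x)"
      using mvt_norm_between t by metis
    have "norm (f' x) \<le> c * \<bar>x\<bar> ^ n" using d x t by (auto simp: dist_real_def)
    also have "\<dots> \<le> c * \<bar>t\<bar> ^ n" using x \<open>c > 0\<close> by (simp add: power_mono)
    finally have "\<bar>t\<bar> * norm (f' x) \<le> \<bar>t\<bar> * (c * \<bar>t\<bar> ^ n)" by (rule mult_left_mono) simp
    with x(3) assms(3) show "norm (norm (f t)) \<le> c * norm (t ^ Suc n)"
      by (simp add: power_abs abs_mult mult_ac)
  qed
qed

lemma smallo_power_if_derivatives_vanish:
  fixes D :: "nat \<Rightarrow> real \<Rightarrow> 'a::real_inner"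
  assumes "open S" "0 \<in> S"
    and "\<And>k t. k < n \<Longrightarrow> t \<in> S \<Longrightarrow> (D k has_vector_derivative D (Suc k) t) (at t)"
    and "isCont (D n) 0"
    and "\<And>k. k \<le> n \<Longrightarrow> D k 0 = 0"
  shows "(\<lambda>t. norm (D 0 t)) \<in> o[at 0](\<lambda>t. t ^ n)"
  using assms(3-5)
proof (induction n arbitrary: D)
  case 0
  then have "((\<lambda>t. norm (D 0 t)) \<longlongrightarrow> 0) (at 0)"
    using tendsto_norm_zero[of "D 0" "at 0"] by (simp add: isCont_def)
  then show ?case by (intro smalloI_tendsto) auto
next
  case (Suc n)
  have "(\<lambda>t. norm (D (Suc 0) t)) \<in> o[at 0](\<lambda>t. t ^ n)"
    using Suc.prems by (intro Suc.IH[of "\<lambda>k. D (Suc k)"]) auto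
  then show ?case
    using Suc.prems assms(1,2)
    by (intro smallo_power_Suc_if_derivative_smallo[of S "D 0" "D (Suc 0)"]) auto
qed

text \<open>For the forward direction, lower orders vanish by induction. Subtracting the monomial with
  the top derivative as coefficient leaves a function whose derivatives all vanish, hence one that
  is small; so the monomial itself is small, which forces its coefficient to be \<open>0\<close>. Working with
  a sequence \<^term>\<open>D\<close> of successive derivatives avoids computing iterated derivatives of composites.\<close>

lemma smallo_power_iff_derivatives_vanish:
  fixes D :: "nat \<Rightarrow> real \<Rightarrow> 'a::real_inner"
  assumes "open S" "0 \<in> S"
    and "\<And>k t. k < n \<Longrightarrow> t \<in> S \<Longrightarrow> (D k has_vector_derivative D (Suc k) t) (at t)"
    and "isCont (D n) 0"
  shows "(\<lambda>t. norm (D 0 t)) \<in> o[at 0](\<lambda>t. t ^ n) \<longleftrightarrow> (\<forall>k\<le>n. D k 0 = 0)"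
proof
  assume "\<forall>k\<le>n. D k 0 = 0"
  then show "(\<lambda>t. norm (D 0 t)) \<in> o[at 0](\<lambda>t. t ^ n)"
    using smallo_power_if_derivatives_vanish[of S n D] assms by blast
next
  assume "(\<lambda>t. norm (D 0 t)) \<in> o[at 0](\<lambda>t. t ^ n)"
  then show "\<forall>k\<le>n. D k 0 = 0"
    using assms(3,4)
  proof (induction n)
    case 0
    then have "((\<lambda>t. norm (D 0 t)) \<longlongrightarrow> 0) (at 0)"
      using smalloD_tendsto by fastforce
    then have "(D 0 \<longlongrightarrow> 0) (at 0)" by (simp add: tendsto_norm_zero_iff)
    moreover have "(D 0 \<longlongrightarrow> D 0 0) (at 0)" using 0 by (simp add: isCont_def)
    ultimately show ?case using LIM_unique by auto
  next
    case (Suc n)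
    define v where "v = D (Suc n) 0"
    define q where "q k t = (t ^ (Suc n - k) / fact (Suc n - k)) *\<^sub>R v" for k and t :: real
    have "(\<lambda>t::real. t ^ Suc n) \<in> O[at 0](\<lambda>t. t ^ n)"
      by (rule landau_o.bigI[of 1])
        (auto simp: eventually_at abs_mult dist_real_def intro!: exI[of _ 1] mult_left_le_one_le)
    with Suc.prems(1) have "(\<lambda>t. norm (D 0 t)) \<in> o[at 0](\<lambda>t. t ^ n)"
      by (rule landau_o.small_big_trans)
    moreover have "isCont (D n) 0"
      using Suc.prems(2)[of n 0] assms(2) has_vector_derivative_continuous by blast
    ultimately have low: "\<forall>k\<le>n. D k 0 = 0"
      using Suc.IH Suc.prems(2) by simp
    have "(\<lambda>t. norm (D 0 t - q 0 t)) \<in> o[at 0](\<lambda>t. t ^ Suc n)"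
    proof (rule smallo_power_if_derivatives_vanish[of S "Suc n" "\<lambda>k t. D k t - q k t"])
      fix k t assume k: "k < Suc n" and "t \<in> S"
      then have m: "Suc n - k = Suc (n - k)" by auto
      have "((\<lambda>t. t ^ Suc (n - k) / fact (Suc (n - k))) has_real_derivative
              t ^ (n - k) / fact (n - k)) (at t)"
        using DERIV_cdivide[OF DERIV_pow[of "Suc (n - k)" t], of "fact (Suc (n - k))"]
        by (simp del: of_nat_Suc)
      from has_vector_derivative_scaleR[OF this has_vector_derivative_const[of v]]
      have "(q k has_vector_derivative q (Suc k) t) (at t)"
        unfolding q_def[abs_def] m diff_Suc_Suc by (simp only: scaleR_zero_right add_0_left)
      then show "((\<lambda>t. D k t - q k t) has_vector_derivative D (Suc k) t - q (Suc k) t) (at t)"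
        using Suc.prems(2)[OF k \<open>t \<in> S\<close>] by (intro has_vector_derivative_diff)
    next
      show "isCont (\<lambda>t. D (Suc n) t - q (Suc n) t) 0"
        using Suc.prems(3) by (simp add: q_def)
    next
      fix k assume "k \<le> Suc n"
      then show "D k 0 - q k 0 = 0"
        using low by (cases "k = Suc n") (auto simp: q_def v_def)
    qed (use assms in auto)
    with Suc.prems(1)
    have "(\<lambda>t. norm (D 0 t) + norm (D 0 t - q 0 t)) \<in> o[at 0](\<lambda>t. t ^ Suc n)"
      by (rule sum_in_smallo(1))
    moreover have "(\<lambda>t. norm (q 0 t)) \<in> O[at 0](\<lambda>t. norm (D 0 t) + norm (D 0 t - q 0 t))"
    proof (rule landau_o.bigI[of 1])
      have "norm (q 0 t) \<le> norm (D 0 t) + norm (D 0 t - q 0 t)" for t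
        using norm_triangle_ineq4[of "D 0 t" "D 0 t - q 0 t"] by simp
      then show "eventually (\<lambda>t. norm (norm (q 0 t))
          \<le> 1 * norm (norm (D 0 t) + norm (D 0 t - q 0 t))) (at 0)" by simp
    qed simp
    ultimately have "(\<lambda>t. norm (q 0 t)) \<in> o[at 0](\<lambda>t. t ^ Suc n)"
      using landau_o.big_small_trans by blast
    then have "((\<lambda>t. norm (q 0 t) / t ^ Suc n) \<longlongrightarrow> 0) (at 0)"
      by (rule smalloD_tendsto)
    then have "((\<lambda>t. \<bar>norm (q 0 t) / t ^ Suc n\<bar>) \<longlongrightarrow> 0) (at 0)"
      by (rule tendsto_rabs_zero)
    moreover have "\<bar>norm (q 0 t) / t ^ Suc n\<bar> = norm v / fact (Suc n)" if "t \<noteq> 0" for t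
    proof -
      have "norm (q 0 t) = \<bar>t ^ Suc n\<bar> * (norm v / fact (Suc n))"
        by (simp add: q_def del: fact_Suc power_Suc)
      then show ?thesis using that by (simp add: abs_mult del: fact_Suc power_Suc)
    qed
    then have "eventually (\<lambda>t. \<bar>norm (q 0 t) / t ^ Suc n\<bar> = norm v / fact (Suc n)) (at 0)"
      by (auto simp: eventually_at_filter simp del: fact_Suc power_Suc)
    ultimately have "((\<lambda>t::real. norm v / fact (Suc n)) \<longlongrightarrow> 0) (at 0)"
      by (rule Lim_transform_eventually)
    then have "norm v / fact (Suc n) = (0::real)"
      using LIM_const_eq by blast
    then have "v = 0" by (simp del: fact_Suc)
    with low show ?case by (auto simp: v_def le_Suc_eq)
  qed
qed

section \<open>Derivatives of a reparametrized curve\<close>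

text \<open>Faa di Bruno's formula up to order \<open>4\<close>: the derivatives of \<open>g \<circ> u\<close> in terms of the
  derivatives \<^term>\<open>a\<close> of \<open>g\<close> at \<open>u(t)\<close> and \<^term>\<open>p\<close> of \<open>u\<close> at \<open>t\<close>. Indexing into a list
  confines \<open>k\<close> to at most \<open>4\<close>.\<close>

definition comp_deriv :: "(nat \<Rightarrow> 'a::real_vector) \<Rightarrow> (nat \<Rightarrow> real) \<Rightarrow> nat \<Rightarrow> 'a" where
  "comp_deriv a p k =
    [a 0,
     p 1 *\<^sub>R a 1,
     p 2 *\<^sub>R a 1 + (p 1)\<^sup>2 *\<^sub>R a 2,
     p 3 *\<^sub>R a 1 + (3 * p 1 * p 2) *\<^sub>R a 2 + (p 1) ^ 3 *\<^sub>R a 3,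
     p 4 *\<^sub>R a 1 + (4 * p 1 * p 3 + 3 * (p 2)\<^sup>2) *\<^sub>R a 2 + (6 * (p 1)\<^sup>2 * p 2) *\<^sub>R a 3
       + (p 1) ^ 4 *\<^sub>R a 4] ! k"

lemma comp_deriv_simps:
  "comp_deriv a p 0 = a 0"
  "comp_deriv a p 1 = p 1 *\<^sub>R a 1"
  "comp_deriv a p 2 = p 2 *\<^sub>R a 1 + (p 1)\<^sup>2 *\<^sub>R a 2"
  "comp_deriv a p 3 = p 3 *\<^sub>R a 1 + (3 * p 1 * p 2) *\<^sub>R a 2 + (p 1) ^ 3 *\<^sub>R a 3"
  "comp_deriv a p 4 = p 4 *\<^sub>R a 1 + (4 * p 1 * p 3 + 3 * (p 2)\<^sup>2) *\<^sub>R a 2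
      + (6 * (p 1)\<^sup>2 * p 2) *\<^sub>R a 3 + (p 1) ^ 4 *\<^sub>R a 4"
  by (simp_all add: comp_deriv_def)

lemma comp_deriv_has_vector_derivative:
  fixes g :: "nat \<Rightarrow> real \<Rightarrow> 'a::real_normed_vector" and u :: "nat \<Rightarrow> real \<Rightarrow> real"
  assumes g: "\<And>j. (g j has_vector_derivative g (Suc j) (u 0 t)) (at (u 0 t))"
    and u: "\<And>j. (u j has_vector_derivative u (Suc j) t) (at t)"
    and "k < 4"
  shows "((\<lambda>t. comp_deriv (\<lambda>j. g j (u 0 t)) (\<lambda>j. u j t) k) has_vector_derivative
           comp_deriv (\<lambda>j. g j (u 0 t)) (\<lambda>j. u j t) (Suc k)) (at t)"
proof -
  have gu: "((\<lambda>t. g j (u 0 t)) has_vector_derivative u 1 t *\<^sub>R g (Suc j) (u 0 t)) (at t)" for j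
    using vector_diff_chain_at[OF u[of 0] g[of j]] by (simp add: o_def)
  have ud: "(u j has_real_derivative u (Suc j) t) (at t)" for j
    using u[of j] by (simp add: has_real_derivative_iff_has_vector_derivative)
  note [derivative_intros] = ud[of 1, simplified] ud[of 2, simplified] ud[of 3, simplified]
  note gs = gu[of 0, simplified] gu[of 1, simplified] gu[of 2, simplified] gu[of 3, simplified]
  \<comment> \<open>The product rule yields several multiples of one derivative; this collects them.\<close>
  have collect: "x *\<^sub>R v + (y *\<^sub>R v + w) = (x + y) *\<^sub>R v + w" for x y and v w :: 'a
    by (simp add: scaleR_left_distrib)
  consider "k = 0" | "k = 1" | "k = 2" | "k = 3" using \<open>k < 4\<close> by linarith
  then show ?thesis
  proof cases
    case 1
    then show ?thesis using gs by (simp add: comp_deriv_def)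
  next
    case 2
    then show ?thesis
      apply (simp add: comp_deriv_def)
      apply (rule has_vector_derivative_eq_rhs)
       apply (rule has_vector_derivative_scaleR derivative_intros gs refl)+
      apply (simp add: algebra_simps numeral_eq_Suc)
      done
  next
    case 3
    then show ?thesis
      apply (simp add: comp_deriv_def)
      apply (rule has_vector_derivative_eq_rhs)
       apply (rule has_vector_derivative_add has_vector_derivative_scaleR derivative_intros gs refl)+
      apply (simp add: algebra_simps numeral_eq_Suc)
      apply (simp add: collect flip: scaleR_left_distrib)
      done
  next
    case 4
    then show ?thesis
      apply (simp add: comp_deriv_def)
      apply (rule has_vector_derivative_eq_rhs)
       apply (rule has_vector_derivative_add has_vector_derivative_scaleR derivative_intros gs refl)+
      apply (simp add: algebra_simps numeral_eq_Suc)
      apply (simp add: collect flip: scaleR_left_distrib)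
      done
  qed
qed

lemma comp_deriv_isCont:
  fixes g :: "nat \<Rightarrow> real \<Rightarrow> 'a::real_normed_vector" and u :: "nat \<Rightarrow> real \<Rightarrow> real"
  assumes g: "\<And>j. isCont (g j) (u 0 t)" and u: "\<And>j. isCont (u j) t"
  shows "isCont (\<lambda>t. comp_deriv (\<lambda>j. g j (u 0 t)) (\<lambda>j. u j t) 4) t"
proof -
  have gu: "isCont (\<lambda>t. g j (u 0 t)) t" for j
    using isCont_o2[OF u[of 0] g[of j]] .
  show ?thesis
    unfolding comp_deriv_simps by (intro continuous_intros gu u)
qed

text \<open>The order of contact criterion applied to \<open>A \<gamma>2(u(t)) + b - \<gamma>1(t)\<close>. The translation
  \<open>b\<close> enters only the condition of order \<open>0\<close>.\<close>

lemma contact_order_4_iff: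
  fixes \<gamma>1 \<gamma>2 :: "real \<Rightarrow> real^2" and A :: "real^2^2"
  assumes J: "open J" "0 \<in> J" "J \<subseteq> I1" "u ` J \<subseteq> I2"
    and smooth: "smooth_on_open I1 \<gamma>1" "smooth_on_open I2 \<gamma>2" "smooth_on_open J u"
    and "u 0 = 0"
  shows "(\<lambda>t. norm (A *v \<gamma>2 (u t) + b - \<gamma>1 t)) \<in> o[at 0](\<lambda>t. t ^ 4) \<longleftrightarrow>
    A *v \<gamma>2 0 + b = \<gamma>1 0 \<and>
    (\<forall>k\<in>{1..4}. A *v comp_deriv (\<lambda>j. nth_derivative j \<gamma>2 0) (\<lambda>j. nth_derivative j u 0) k
      = nth_derivative k \<gamma>1 0)"
proof -
  define C where
    "C k t = comp_deriv (\<lambda>j. nth_derivative j \<gamma>2 (nth_derivative 0 u t)) (\<lambda>j. nth_derivative j u t) k"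
    for k t
  define D where "D k t = A *v C k t + (if k = 0 then b else 0) - nth_derivative k \<gamma>1 t" for k t
  have d1: "(nth_derivative j \<gamma>1 has_vector_derivative nth_derivative (Suc j) \<gamma>1 t) (at t)"
    and d2: "(nth_derivative j \<gamma>2 has_vector_derivative
          nth_derivative (Suc j) \<gamma>2 (nth_derivative 0 u t)) (at (nth_derivative 0 u t))"
    and d3: "(nth_derivative j u has_vector_derivative nth_derivative (Suc j) u t) (at t)"
    if "t \<in> J" for j t
    using smooth J(3,4) that by (auto intro!: smooth_on_open_has_vector_derivative)
  have "(\<lambda>t. norm (D 0 t)) \<in> o[at 0](\<lambda>t. t ^ 4) \<longleftrightarrow> (\<forall>k\<le>4. D k 0 = 0)"
  proof (rule smallo_power_iff_derivatives_vanish[OF J(1,2)])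
    fix k :: nat and t assume k: "k < 4" and t: "t \<in> J"
    have "(C k has_vector_derivative C (Suc k) t) (at t)"
      using comp_deriv_has_vector_derivative[where g = "\<lambda>j. nth_derivative j \<gamma>2"
          and u = "\<lambda>j. nth_derivative j u" and t = t, OF d2 d3 k] t
      by (simp add: C_def[abs_def])
    from bounded_linear.has_vector_derivative[OF matrix_vector_mul_bounded_linear this, of A]
    have "((\<lambda>t. A *v C k t + (if k = 0 then b else 0) - nth_derivative k \<gamma>1 t)
        has_vector_derivative A *v C (Suc k) t + 0 - nth_derivative (Suc k) \<gamma>1 t) (at t)"
      by (intro has_vector_derivative_diff has_vector_derivative_add has_vector_derivative_const
          d1[OF t])
    then show "(D k has_vector_derivative D (Suc k) t) (at t)"
      by (simp add: D_def[abs_def])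
  next
    have "isCont (C 4) 0"
      unfolding C_def[abs_def]
    proof (rule comp_deriv_isCont[where g = "\<lambda>j. nth_derivative j \<gamma>2"
          and u = "\<lambda>j. nth_derivative j u"])
      show "isCont (nth_derivative j \<gamma>2) (nth_derivative 0 u 0)" for j
        by (rule has_vector_derivative_continuous[OF d2[OF J(2)]])
      show "isCont (nth_derivative j u) 0" for j
        by (rule has_vector_derivative_continuous[OF d3[OF J(2)]])
    qed
    then have "isCont (\<lambda>t. A *v C 4 t) 0"
      by (rule bounded_linear.isCont[OF matrix_vector_mul_bounded_linear])
    moreover have "isCont (nth_derivative 4 \<gamma>1) 0"
      by (rule has_vector_derivative_continuous[OF d1[OF J(2)]])
    ultimately show "isCont (D 4) 0"
      by (simp add: D_def[abs_def])
  qed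
  moreover have "{..4} = insert 0 {1..4::nat}" by auto
  then have "(\<forall>k\<le>4. D k 0 = 0) \<longleftrightarrow> D 0 0 = 0 \<and> (\<forall>k\<in>{1..4}. D k 0 = 0)"
    by (metis (no_types, lifting) atMost_iff insert_iff)
  ultimately show ?thesis
    using \<open>u 0 = 0\<close> by (auto simp: D_def C_def comp_deriv_simps(1))
qed

section \<open>The area form of the plane\<close>

lemma bracket_simps [simp]:
  "bracket (x + y) z = bracket x z + bracket y z"
  "bracket x (y + z) = bracket x y + bracket x z"
  "bracket (c *\<^sub>R x) y = c * bracket x y"
  "bracket x (c *\<^sub>R y) = c * bracket x y"
  "bracket x x = 0"
  by (simp_all add: bracket_def algebra_simps)

lemma bracket_commute: "bracket y x = - bracket x y"
  by (simp add: bracket_def)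

lemma bracket_matrix_vector_mult:
  fixes A :: "real^2^2"
  shows "bracket (A *v x) (A *v y) = det A * bracket x y"
  by (simp add: bracket_def det_2 matrix_vector_mult_def sum_2 algebra_simps)

lemma bracket_eq_0_imp_parallel:
  assumes "bracket x y = 0" "x \<noteq> 0"
  obtains c where "y = c *\<^sub>R x"
proof (cases "x $ 1 = 0")
  case True
  then have "x $ 2 \<noteq> 0" using assms(2) by (auto simp: vec_eq_iff forall_2)
  then have "y = (y $ 2 / x $ 2) *\<^sub>R x"
    using True assms(1) by (auto simp: vec_eq_iff forall_2 bracket_def)
  then show thesis by (rule that)
next
  case False
  then have "y = (y $ 1 / x $ 1) *\<^sub>R x"
    using assms(1) by (auto simp: vec_eq_iff forall_2 bracket_def field_simps)
  then show thesis by (rule that)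
qed

text \<open>The matrix \<open>A\<close> is the one that maps the frame \<open>(c, d)\<close> to \<open>(c', d')\<close>. By Cramer's rule the
  brackets of \<open>x\<close> with the two frame vectors are, up to the common factor \<open>[c, d] = [c', d']\<close>, the
  coordinates of \<open>x\<close>, so equal brackets characterize corresponding vectors.\<close>

lemma unimodular_matrix_of_frames:
  assumes "bracket c d = bracket c' d'" "bracket c d \<noteq> 0"
  obtains A :: "real^2^2" where "det A = 1"
    and "\<And>x y. bracket x d = bracket y d' \<Longrightarrow> bracket c x = bracket c' y \<Longrightarrow> A *v x = y"
proof
  let ?A = "(1 / bracket c d) *\<^sub>R
    (vector [vector [d $ 2 * c' $ 1 - c $ 2 * d' $ 1, c $ 1 * d' $ 1 - d $ 1 * c' $ 1],
             vector [d $ 2 * c' $ 2 - c $ 2 * d' $ 2, c $ 1 * d' $ 2 - d $ 1 * c' $ 2]]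
      :: real^2^2)"
  have "det (k *\<^sub>R (vector [vector [e, f], vector [g, h]] :: real^2^2)) = k\<^sup>2 * (e * h - f * g)"
    for k e f g h :: real
    by (simp add: det_2 power2_eq_square algebra_simps)
  then have "det ?A = (1 / bracket c d)\<^sup>2 *
      ((d $ 2 * c' $ 1 - c $ 2 * d' $ 1) * (c $ 1 * d' $ 2 - d $ 1 * c' $ 2) -
       (c $ 1 * d' $ 1 - d $ 1 * c' $ 1) * (d $ 2 * c' $ 2 - c $ 2 * d' $ 2))" .
  also have "\<dots> = (1 / bracket c d)\<^sup>2 * (bracket c d * bracket c' d')"
    by (simp add: bracket_def algebra_simps)
  finally have "det ?A = (1 / bracket c d)\<^sup>2 * (bracket c d * bracket c' d')" .
  then show "det ?A = 1" using assms by (simp add: power2_eq_square)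
  fix x y assume xy: "bracket x d = bracket y d'" "bracket c x = bracket c' y"
  have "(k *\<^sub>R (vector [vector [e, f], vector [g, h]] :: real^2^2)) *v x =
      k *\<^sub>R vector [e * x $ 1 + f * x $ 2, g * x $ 1 + h * x $ 2]" for k e f g h :: real
    by (simp add: vec_eq_iff forall_2 matrix_vector_mult_def sum_2 algebra_simps)
  then have "?A *v x = (1 / bracket c d) *\<^sub>R
      vector [(d $ 2 * c' $ 1 - c $ 2 * d' $ 1) * x $ 1 + (c $ 1 * d' $ 1 - d $ 1 * c' $ 1) * x $ 2,
        (d $ 2 * c' $ 2 - c $ 2 * d' $ 2) * x $ 1 + (c $ 1 * d' $ 2 - d $ 1 * c' $ 2) * x $ 2]" .
  also have "vector [(d $ 2 * c' $ 1 - c $ 2 * d' $ 1) * x $ 1 + (c $ 1 * d' $ 1 - d $ 1 * c' $ 1) * x $ 2,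
        (d $ 2 * c' $ 2 - c $ 2 * d' $ 2) * x $ 1 + (c $ 1 * d' $ 2 - d $ 1 * c' $ 2) * x $ 2]
      = bracket x d *\<^sub>R c' + bracket c x *\<^sub>R d'"
    by (simp add: vec_eq_iff forall_2 bracket_def algebra_simps)
  also have "bracket x d *\<^sub>R c' + bracket c x *\<^sub>R d' = bracket c' d' *\<^sub>R y"
    unfolding xy by (simp add: vec_eq_iff forall_2 bracket_def algebra_simps)
  finally show "?A *v x = y" using assms by simp
qed

section \<open>Equivalence of jets\<close>

definition curvature_numerator :: "(nat \<Rightarrow> real^2) \<Rightarrow> real" where
  "curvature_numerator a = bracket (a 1) (a 4) - 6 * bracket (a 2) (a 3)"

text \<open>The derivatives of order at least \<open>2\<close> of the parameter change disappear. In
  \<^const>\<open>curvature_numerator\<close>, \<open>[c\<^sub>1, c\<^sub>4]\<close> contributes \<open>6 p\<^sub>1\<^sup>3 p\<^sub>2 [a\<^sub>1, a\<^sub>3]\<close>, which the term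
  \<open>6 [c\<^sub>2, c\<^sub>3]\<close> cancels; all else that contains them is a multiple of \<open>[a\<^sub>1, a\<^sub>2] = 0\<close>.\<close>

lemma comp_deriv_brackets:
  assumes "bracket (a 1) (a 2) = 0"
  shows "bracket (comp_deriv a p 1) (comp_deriv a p 3) = p 1 ^ 4 * bracket (a 1) (a 3)"
    and "curvature_numerator (comp_deriv a p) = p 1 ^ 5 * curvature_numerator a"
proof -
  have "bracket (a 2) (a 1) = 0" using assms bracket_commute[of "a 1" "a 2"] by simp
  then show "bracket (comp_deriv a p 1) (comp_deriv a p 3) = p 1 ^ 4 * bracket (a 1) (a 3)"
    and "curvature_numerator (comp_deriv a p) = p 1 ^ 5 * curvature_numerator a"
    unfolding curvature_numerator_def comp_deriv_simps
    using assms by (simp_all add: algebra_simps numeral_eq_Suc)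
qed

lemma scaling_if_jets_equivalent:
  fixes A :: "real^2^2"
  assumes "bracket (a 1) (a 2) = 0" "det A = 1"
    and jets: "\<And>k. k \<in> {1..4} \<Longrightarrow> A *v comp_deriv a p k = b k"
  shows "bracket (b 1) (b 3) = p 1 ^ 4 * bracket (a 1) (a 3)"
    and "curvature_numerator b = p 1 ^ 5 * curvature_numerator a"
proof -
  have "bracket (b i) (b j) = bracket (comp_deriv a p i) (comp_deriv a p j)"
    if "i \<in> {1..4}" "j \<in> {1..4}" for i j
    using bracket_matrix_vector_mult[of A] jets that assms(2) by (metis mult_1)
  then show "bracket (b 1) (b 3) = p 1 ^ 4 * bracket (a 1) (a 3)"
    and "curvature_numerator b = p 1 ^ 5 * curvature_numerator a"
    using comp_deriv_brackets[OF assms(1), of p] by (simp_all add: curvature_numerator_def)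
qed

text \<open>Matching the derivatives of order \<open>1\<close> and \<open>3\<close> determines \<open>A\<close>, matching order \<open>2\<close>
  determines \<open>p\<^sub>2\<close>, and order \<open>4\<close> determines \<open>p\<^sub>4\<close> in one coordinate and is a consequence of the
  scaling of \<^const>\<open>curvature_numerator\<close> in the other. The derivative \<open>p\<^sub>3\<close> is free and is set to
  \<open>0\<close>.\<close>

lemma jets_equivalent_if_scaling:
  assumes a: "bracket (a 1) (a 2) = 0" "bracket (a 1) (a 3) \<noteq> 0"
    and b: "bracket (b 1) (b 2) = 0"
    and "r > 0"
    and s3: "bracket (b 1) (b 3) = r ^ 4 * bracket (a 1) (a 3)"
    and s4: "curvature_numerator b = r ^ 5 * curvature_numerator a"
  shows "\<exists>(A :: real^2^2) q s. det A = 1 \<and>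
    (\<forall>p. p 1 = r \<and> p 2 = q \<and> p 3 = 0 \<and> p 4 = s \<longrightarrow>
      (\<forall>k\<in>{1..4}. A *v comp_deriv a p k = b k))"
proof -
  have b13: "bracket (b 1) (b 3) \<noteq> 0" using s3 a(2) \<open>r > 0\<close> by simp
  have "a 1 \<noteq> 0" "b 1 \<noteq> 0" using a(2) b13 by (auto simp: bracket_def)
  then obtain \<kappa> \<nu> where par: "a 2 = \<kappa> *\<^sub>R a 1" "b 2 = \<nu> *\<^sub>R b 1"
    using bracket_eq_0_imp_parallel a(1) b by metis
  \<comment> \<open>The solution of \<open>q + r\<^sup>2 \<kappa> = r \<nu>\<close>, so that \<open>c\<^sub>2 = \<nu> c\<^sub>1\<close>, just as \<open>b\<^sub>2 = \<nu> b\<^sub>1\<close>.\<close>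
  define q where "q = r * \<nu> - r\<^sup>2 * \<kappa>"
  define c3 where "c3 = (3 * r * q) *\<^sub>R a 2 + r ^ 3 *\<^sub>R a 3"
  \<comment> \<open>The part of the fourth derivative that does not involve \<open>s\<close>.\<close>
  define c4 where "c4 = (3 * q\<^sup>2) *\<^sub>R a 2 + (6 * r\<^sup>2 * q) *\<^sub>R a 3 + r ^ 4 *\<^sub>R a 4"
  \<comment> \<open>The solution of \<open>[s a\<^sub>1 + c4, c3] = [b\<^sub>4, b\<^sub>3]\<close>, because \<open>[a\<^sub>1, c3] = r\<^sup>3 [a\<^sub>1, a\<^sub>3]\<close>.\<close>
  define s where "s = (bracket (b 4) (b 3) - bracket c4 c3) / (r ^ 3 * bracket (a 1) (a 3))"
  define p where "p = (\<lambda>j::nat. 0)(1 := r, 2 := q, 4 := s)"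
  define c where "c = comp_deriv a p"
  have cs: "c 1 = r *\<^sub>R a 1" "c 2 = \<nu> *\<^sub>R c 1" "c 3 = c3" "c 4 = s *\<^sub>R a 1 + c4"
    unfolding c_def comp_deriv_simps
    using par by (simp_all add: p_def c3_def c4_def q_def algebra_simps power2_eq_square)
  have c13: "bracket (c 1) (c 3) = bracket (b 1) (b 3)"
    using comp_deriv_brackets(1)[OF a(1), of p] s3 by (simp add: c_def p_def)
  have c23: "bracket (c 2) (c 3) = bracket (b 2) (b 3)"
    using c13 by (simp add: cs(2) par(2))
  have "curvature_numerator c = curvature_numerator b"
    using comp_deriv_brackets(2)[OF a(1), of p] s4 by (simp add: c_def p_def)
  then have c14: "bracket (c 1) (c 4) = bracket (b 1) (b 4)"
    using c23 by (simp add: curvature_numerator_def)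
  have "bracket (a 1) c3 = r ^ 3 * bracket (a 1) (a 3)"
    using a(1) by (simp add: c3_def)
  then have c43: "bracket (c 4) (c 3) = bracket (b 4) (b 3)"
    using a(2) \<open>r > 0\<close> by (simp add: cs s_def)
  obtain A :: "real^2^2" where A: "det A = 1"
    and Ax: "\<And>x y. bracket x (c 3) = bracket y (b 3) \<Longrightarrow> bracket (c 1) x = bracket (b 1) y
      \<Longrightarrow> A *v x = y"
    using unimodular_matrix_of_frames[OF c13] c13 b13 by metis
  have "A *v c 1 = b 1" "A *v c 3 = b 3" "A *v c 4 = b 4"
    using c13 c14 c43 by (auto intro: Ax)
  moreover have "A *v c 2 = b 2"
    using c23 b cs(2) by (auto intro!: Ax)
  ultimately have Ac: "A *v c k = b k" if "k \<in> {1..4}" for k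
  proof -
    have "k = 1 \<or> k = 2 \<or> k = 3 \<or> k = 4" using that by auto
    then show ?thesis using \<open>A *v c 2 = b 2\<close> \<open>A *v c 1 = b 1\<close> \<open>A *v c 3 = b 3\<close> \<open>A *v c 4 = b 4\<close>
      by metis
  qed
  show ?thesis
  proof (intro exI conjI allI impI ballI)
    show "det A = 1" by (rule A)
    fix p' :: "nat \<Rightarrow> real" and k assume "p' 1 = r \<and> p' 2 = q \<and> p' 3 = 0 \<and> p' 4 = s"
      and k: "k \<in> {1..4::nat}"
    then have p': "p' 1 = r" "p' 2 = q" "p' 3 = 0" "p' 4 = s" by blast+
    have "k = 1 \<or> k = 2 \<or> k = 3 \<or> k = 4" using k by auto
    then have "comp_deriv a p' k = c k"
      using p' by (elim disjE) (simp_all only: c_def comp_deriv_simps p_def, simp_all)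
    then show "A *v comp_deriv a p' k = b k" using Ac[OF k] by simp
  qed
qed

section \<open>Curvature as an invariant of the scaling action\<close>

lemma affine_inflectional_curvature_positive:
  assumes "positive_generic_inflection_at_0 \<gamma>"
  shows "affine_inflectional_curvature \<gamma> = curvature_numerator (\<lambda>k. nth_derivative k \<gamma> 0) /
    bracket (nth_derivative 1 \<gamma> 0) (nth_derivative 3 \<gamma> 0) powr (5/4)"
  using assms
  by (simp add: affine_inflectional_curvature_def positive_generic_inflection_at_0_def
      curvature_numerator_def)

text \<open>The exponent \<open>5/4\<close> makes the quotient invariant under weights \<open>4\<close> and \<open>5\<close>, and for positive
  denominators the orbit is recovered with \<open>r = (L' / L)\<^bsup>1/4\<^esup>\<close>.\<close>

lemma weighted_ratio_eq_iff_scaling: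
  fixes L L' N N' :: real
  assumes "L > 0" "L' > 0"
  shows "N / L powr (5/4) = N' / L' powr (5/4) \<longleftrightarrow> (\<exists>r>0. L' = r ^ 4 * L \<and> N' = r ^ 5 * N)"
proof -
  have pow: "(r ^ 4 * L) powr (5/4) = r ^ 5 * L powr (5/4)" if "r > 0" for r :: real
  proof -
    have "(r ^ 4) powr (5/4) = (r powr 4) powr (5/4)" using that by (simp add: powr_numeral)
    also have "\<dots> = r ^ 5" using that by (simp only: powr_powr) (simp add: powr_numeral)
    finally show ?thesis using that assms by (simp add: powr_mult)
  qed
  show ?thesis
  proof
    assume eq: "N / L powr (5/4) = N' / L' powr (5/4)"
    define r where "r = (L' / L) powr (1/4)"
    have "r > 0" using assms by (simp add: r_def)
    have "r ^ 4 = r powr 4" using \<open>r > 0\<close> by (simp add: powr_numeral)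
    also have "\<dots> = L' / L" using assms by (simp only: r_def powr_powr) simp
    finally have "r ^ 4 = L' / L" .
    then have L': "L' = r ^ 4 * L" using assms by simp
    have "N' = r ^ 5 * N"
      using eq assms \<open>r > 0\<close> unfolding L' pow[OF \<open>r > 0\<close>] by (simp add: field_simps)
    with L' \<open>r > 0\<close> show "\<exists>r>0. L' = r ^ 4 * L \<and> N' = r ^ 5 * N" by blast
  next
    assume "\<exists>r>0. L' = r ^ 4 * L \<and> N' = r ^ 5 * N"
    then obtain r where r: "r > 0" "L' = r ^ 4 * L" "N' = r ^ 5 * N" by blast
    show "N / L powr (5/4) = N' / L' powr (5/4)"
      unfolding r(2,3) pow[OF r(1)] using r(1) assms by simp
  qed
qed

section \<open>Realising a jet by a parameter change\<close>

lemma nth_derivative_poly: "nth_derivative k (poly P) = poly ((pderiv ^^ k) P)"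
proof (induction k)
  case (Suc k)
  have "vector_derivative (poly Q) (at t) = poly (pderiv Q) t" for Q :: "real poly" and t
    using poly_DERIV[of Q t]
    by (simp add: has_real_derivative_iff_has_vector_derivative vector_derivative_at)
  then show ?case by (simp add: nth_derivative_Suc Suc)
qed simp

lemma smooth_on_open_poly: "smooth_on_open J (poly P)" for P :: "real poly"
  unfolding smooth_on_open_def nth_derivative_poly
  by (meson poly_DERIV real_differentiable_def differentiable_def has_field_derivative_def)

lemma deriv_eq_nth_derivative_1:
  assumes "smooth_on_open J u" "t \<in> J"
  shows "deriv u t = nth_derivative 1 u t"
  using smooth_on_open_has_vector_derivative[OF assms, of 0]
  by (simp add: DERIV_imp_deriv has_real_derivative_iff_has_vector_derivative)

text \<open>The Taylor polynomial with the prescribed derivatives does it; the interval is shrunk by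
  continuity so that the polynomial is increasing there and stays inside the given domains.\<close>

lemma jet_realised_by_reparametrization:
  fixes r q s :: real
  assumes "open_interval_around_0 I1" "open_interval_around_0 I2" "r > 0"
  obtains J u where "open_interval_around_0 J" "J \<subseteq> I1" "u ` J \<subseteq> I2" "smooth_on_open J u"
    "u 0 = 0" "\<forall>t\<in>J. deriv u t > 0"
    "nth_derivative 1 u 0 = r" "nth_derivative 2 u 0 = q" "nth_derivative 3 u 0 = 0"
    "nth_derivative 4 u 0 = s"
proof -
  define P where "P = [:0, r, q / 2, 0, s / 24:]"
  have I: "open I1" "0 \<in> I1" "open I2" "0 \<in> I2"
    using assms by (auto simp: open_interval_around_0_def)
  have poly_tendsto: "(poly Q \<longlongrightarrow> poly Q 0) (nhds 0)" for Q :: "real poly"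
    using poly_isCont[of 0 Q] by (simp add: isCont_def tendsto_at_iff_tendsto_nhds)
  have "eventually (\<lambda>t. t \<in> I1) (nhds 0)"
    using I by (simp add: eventually_nhds_in_open)
  moreover have "eventually (\<lambda>t. poly P t \<in> I2) (nhds 0)"
    using topological_tendstoD[OF poly_tendsto[of P] I(3)] I(4) by (simp add: P_def)
  moreover have "eventually (\<lambda>t. poly (pderiv P) t > 0) (nhds 0)"
    using order_tendstoD(1)[OF poly_tendsto[of "pderiv P"], of 0] \<open>r > 0\<close>
    by (simp add: P_def pderiv_pCons)
  ultimately have "eventually (\<lambda>t. t \<in> I1 \<and> poly P t \<in> I2 \<and> poly (pderiv P) t > 0) (nhds 0)"
    by eventually_elim simp
  then obtain d where d: "d > 0"
    "\<And>t. dist t 0 < d \<Longrightarrow> t \<in> I1 \<and> poly P t \<in> I2 \<and> poly (pderiv P) t > 0"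
    unfolding eventually_nhds_metric by blast
  show thesis
  proof
    show "open_interval_around_0 (ball 0 d)"
      using d(1) by (simp add: open_interval_around_0_def is_interval_ball_real)
    show "ball 0 d \<subseteq> I1" "poly P ` ball 0 d \<subseteq> I2"
      using d(2) by (auto simp: dist_commute)
    show "smooth_on_open (ball 0 d) (poly P)" by (rule smooth_on_open_poly)
    show "poly P 0 = 0" by (simp add: P_def)
    show "\<forall>t\<in>ball 0 d. deriv (poly P) t > 0"
      using d(2) DERIV_imp_deriv[OF poly_DERIV[of P]] by (auto simp: dist_norm)
    show "nth_derivative 1 (poly P) 0 = r" "nth_derivative 2 (poly P) 0 = q"
      "nth_derivative 3 (poly P) 0 = 0" "nth_derivative 4 (poly P) 0 = s"
      by (simp_all add: nth_derivative_poly P_def pderiv_pCons numeral_eq_Suc)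
  qed
qed

section \<open>The classification up to order four\<close>

theorem theorem4p2:
  fixes \<gamma>1 \<gamma>2 :: "real \<Rightarrow> real^2" and I1 I2 :: "real set"
  assumes "open_interval_around_0 I1" and "open_interval_around_0 I2"
    and "regular_smooth_curve I1 \<gamma>1" and "regular_smooth_curve I2 \<gamma>2"
    and "positive_generic_inflection_at_0 \<gamma>1" and "positive_generic_inflection_at_0 \<gamma>2"
  shows "affine_inflectional_curvature \<gamma>1 = affine_inflectional_curvature \<gamma>2 \<longleftrightarrow>
    (\<exists>(T :: real^2 \<Rightarrow> real^2) (J :: real set) (u :: real \<Rightarrow> real).
        orientation_preserving_equi_affine T \<and>
        open_interval_around_0 J \<and> J \<subseteq> I1 \<and> u ` J \<subseteq> I2 \<and>
        smooth_on_open J u \<and> u 0 = 0 \<and> (\<forall>t\<in>J. deriv u t > 0) \<and>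
        (\<lambda>t. norm (T (\<gamma>2 (u t)) - \<gamma>1 t)) \<in> o[at 0](\<lambda>t. t ^ 4))"
proof -
  define a b where "a k = nth_derivative k \<gamma>2 0" and "b k = nth_derivative k \<gamma>1 0" for k
  have smooth: "smooth_on_open I1 \<gamma>1" "smooth_on_open I2 \<gamma>2"
    using assms(3,4) by (auto simp: regular_smooth_curve_def)
  have a: "bracket (a 1) (a 2) = 0" "bracket (a 1) (a 3) > 0"
    and b: "bracket (b 1) (b 2) = 0" "bracket (b 1) (b 3) > 0"
    using assms(5,6) by (auto simp: positive_generic_inflection_at_0_def a_def b_def
        generic_inflection_at_0_def inflection_at_0_def)
  have "affine_inflectional_curvature \<gamma>1 = affine_inflectional_curvature \<gamma>2 \<longleftrightarrow>
      curvature_numerator a / bracket (a 1) (a 3) powr (5/4) =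
      curvature_numerator b / bracket (b 1) (b 3) powr (5/4)"
    using affine_inflectional_curvature_positive[OF assms(5)]
      affine_inflectional_curvature_positive[OF assms(6)]
    by (auto simp: a_def[abs_def] b_def[abs_def])
  also have "\<dots> \<longleftrightarrow> (\<exists>r>0. bracket (b 1) (b 3) = r ^ 4 * bracket (a 1) (a 3) \<and>
      curvature_numerator b = r ^ 5 * curvature_numerator a)"
    using a b by (intro weighted_ratio_eq_iff_scaling)
  finally have scaling: "affine_inflectional_curvature \<gamma>1 = affine_inflectional_curvature \<gamma>2 \<longleftrightarrow>
      (\<exists>r>0. bracket (b 1) (b 3) = r ^ 4 * bracket (a 1) (a 3) \<and>
        curvature_numerator b = r ^ 5 * curvature_numerator a)" .
  have contact: "(\<lambda>t. norm (A *v \<gamma>2 (u t) + v - \<gamma>1 t)) \<in> o[at 0](\<lambda>t. t ^ 4) \<longleftrightarrow>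
      A *v a 0 + v = b 0 \<and>
      (\<forall>k\<in>{1..4}. A *v comp_deriv a (\<lambda>j. nth_derivative j u 0) k = b k)"
    if "open_interval_around_0 J" "J \<subseteq> I1" "u ` J \<subseteq> I2" "smooth_on_open J u" "u 0 = 0"
    for A :: "real^2^2" and v J u
    using contact_order_4_iff[of J I1 u I2 \<gamma>1 \<gamma>2 A v] that smooth
    by (simp add: a_def[abs_def] b_def open_interval_around_0_def)
  show ?thesis
  proof
    assume "affine_inflectional_curvature \<gamma>1 = affine_inflectional_curvature \<gamma>2"
    then obtain r where "r > 0"
      and r: "bracket (b 1) (b 3) = r ^ 4 * bracket (a 1) (a 3)"
        "curvature_numerator b = r ^ 5 * curvature_numerator a"
      using scaling by blast
    obtain A :: "real^2^2" and q s where A: "det A = 1"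
      and jets: "\<forall>p. p 1 = r \<and> p 2 = q \<and> p 3 = 0 \<and> p 4 = s \<longrightarrow>
        (\<forall>k\<in>{1..4}. A *v comp_deriv a p k = b k)"
      using jets_equivalent_if_scaling[OF a(1) less_imp_neq[OF a(2), symmetric] b(1) \<open>r > 0\<close> r]
      by blast
    obtain J u where J: "open_interval_around_0 J" "J \<subseteq> I1" "u ` J \<subseteq> I2" "smooth_on_open J u"
      "u 0 = 0" and pos: "\<forall>t\<in>J. deriv u t > 0"
      and u: "nth_derivative 1 u 0 = r" "nth_derivative 2 u 0 = q" "nth_derivative 3 u 0 = 0"
        "nth_derivative 4 u 0 = s"
      using jet_realised_by_reparametrization[OF assms(1,2) \<open>r > 0\<close>, of q s] by blast
    define T where "T = (\<lambda>x. A *v x + (b 0 - A *v a 0))"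
    have "(\<lambda>t. norm (T (\<gamma>2 (u t)) - \<gamma>1 t)) \<in> o[at 0](\<lambda>t. t ^ 4)"
      using jets[rule_format, of "\<lambda>j. nth_derivative j u 0"] u
      unfolding T_def contact[OF J] by simp
    moreover have "orientation_preserving_equi_affine T"
      using A by (auto simp: orientation_preserving_equi_affine_def T_def)
    ultimately show "\<exists>T J u. orientation_preserving_equi_affine T \<and>
        open_interval_around_0 J \<and> J \<subseteq> I1 \<and> u ` J \<subseteq> I2 \<and>
        smooth_on_open J u \<and> u 0 = 0 \<and> (\<forall>t\<in>J. deriv u t > 0) \<and>
        (\<lambda>t. norm (T (\<gamma>2 (u t)) - \<gamma>1 t)) \<in> o[at 0](\<lambda>t. t ^ 4)"
      using J pos by blast
  next
    assume "\<exists>T J u. orientation_preserving_equi_affine T \<and>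
        open_interval_around_0 J \<and> J \<subseteq> I1 \<and> u ` J \<subseteq> I2 \<and>
        smooth_on_open J u \<and> u 0 = 0 \<and> (\<forall>t\<in>J. deriv u t > 0) \<and>
        (\<lambda>t. norm (T (\<gamma>2 (u t)) - \<gamma>1 t)) \<in> o[at 0](\<lambda>t. t ^ 4)"
    then obtain T J u where T: "orientation_preserving_equi_affine T"
      and J: "open_interval_around_0 J" "J \<subseteq> I1" "u ` J \<subseteq> I2" "smooth_on_open J u" "u 0 = 0"
      and pos: "\<forall>t\<in>J. deriv u t > 0"
      and small: "(\<lambda>t. norm (T (\<gamma>2 (u t)) - \<gamma>1 t)) \<in> o[at 0](\<lambda>t. t ^ 4)"
      by blast
    obtain A :: "real^2^2" and v where A: "det A = 1" "T = (\<lambda>x. A *v x + v)"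
      using T by (auto simp: orientation_preserving_equi_affine_def)
    define p where "p j = nth_derivative j u 0" for j
    have "\<And>k. k \<in> {1..4} \<Longrightarrow> A *v comp_deriv a p k = b k"
      using small contact[OF J] unfolding A(2) p_def[abs_def] by blast
    note scaling_if_jets_equivalent[OF a(1) A(1) this]
    moreover have "p 1 > 0"
      using deriv_eq_nth_derivative_1[OF J(4), of 0] J(1) pos
      by (auto simp: p_def open_interval_around_0_def)
    ultimately show "affine_inflectional_curvature \<gamma>1 = affine_inflectional_curvature \<gamma>2"
      unfolding scaling by blast
  qed
qed

end
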